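(* Let $X$ be a two-sided shift space on a finite alphabet and $\varphi\colon X\to\mathbb R$ a continuous potential. If $\varphi$ has the Walters property, then the unstable leaf measures $m^{\mathrm u}_x$ have uniformly continuous holonomies on the family of open rectangles (rectangles that are open subsets of $X$).
   Context: Let $A$ be a finite set and $\sigma\colon A^{\mathbb Z}\to A^{\mathbb Z}$ the shift $(\sigma x)_n=x_{n+1}$; $A^{\mathbb Z}$ has the metric $d(x,y)=2^{-\min\{|n|:x_n\ne y_n\}}$. A two-sided shift space is a (nonempty) closed $\sigma$-invariant set $X\subset A^{\mathbb Z}$. For $w\in A^n$ (length $|w|=n$) let $[w]^+=\{x\in X:x_{[0,n)}=w\}$; $\mathcal L_n=\{w\in A^n:[w]^+\ne\emptyset\}$, $\mathcal L=\bigcup_{n\ge0}\mathcal L_n$, $\mathcal L_{\ge N}=\{w\in\mathcal L:|w|\ge N\}$. Let $S_n\varphi(x)=\sum_{k=0}^{n-1}\varphi(\sigma^kx)$, $\Phi(w)=\sup_{x\in[w]^+}S_{|w|}\varphi(x)$, $\Lambda_n=\sum_{w\in\mathcal L_n}e^{\Phi(w)}$, $P=\lim_n\frac1n\log\Lambda_n$. Walters property: for every $\epsilon>0$ there is $k\in\mathbb N$ such that for all $n\in\mathbb N$ and $x,y\in X$ with $x_{[-k,n+k)}=y_{[-k,n+k)}$ we have $|S_n\varphi(x)-S_n\varphi(y)|\le\epsilon$. Unstable leaves and leaf measures: $W^{\mathrm u}_{\mathrm{loc}}(x)=\{y\in X:y_k=x_k\ \forall k\le0\}$; $\Phi^+_x(w)=\sup\{S_{|w|}\varphi(y):y\in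 W^{\mathrm u}_{\mathrm{loc}}(x)\cap[w]^+\}$ ($\sup\emptyset=-\infty$, $e^{-\infty}=0$); $\mathbb E^+(Z,N)=\{\mathcal E\subset\mathcal L_{\ge N}:Z\subset\bigcup_{w\in\mathcal E}[w]^+\}$; $$m^{\mathrm u}_x(Z)=\lim_{N\to\infty}\inf\Big\{\sum_{w\in\mathcal E}e^{\Phi^+_x(w)-|w|P}:\mathcal E\in\mathbb E^+(Z,N)\Big\}\quad(Z\subset W^{\mathrm u}_{\mathrm{loc}}(x)),$$ which is a Borel measure on $W^{\mathrm u}_{\mathrm{loc}}(x)$. Rectangles and holonomies: for $x,y\in X$ with $x_0=y_0$, $[x,y]$ is the sequence with $[x,y]_n=x_n$ for $n\le0$ and $[x,y]_n=y_n$ for $n\ge0$. A set $R\subset X$ is a rectangle if for all $x,y\in R$ the bracket $[x,y]$ is defined (so $x_0=y_0$) and lies in $R$. For $x\in R$, $W^{\mathrm u}_R(x)=W^{\mathrm u}_{\mathrm{loc}}(x)\cap R$. For $z,y\in R$ the stable holonomy $\pi^s_{z,y}\colon W^{\mathrm u}_R(z)\to W^{\mathrm u}_R(y)$ is $\pi^s_{z,y}(x)=[y,x]$. The leaf measures $m^{\mathrm u}_x$ have uniformly continuous holonomies on a collection $\mathcal R$ of rectangles if for every $\epsilon>0$ there is $\delta>0$ such that for all $R\in\mathcal R$ and $y,z\in R$ with $d(y,z)<\delta$ we have $e^{-\epsilon}m^{\mathrm u}_z(\pi^s_{y,z}(Y))\le m^{\mathrm u}_y(Y)\le e^{\epsilon}m^{\mathrm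 u}_z(\pi^s_{y,z}(Y))$ for all measurable $Y\subset W^{\mathrm u}_R(y)$. *)

theory Defs
  imports "HOL-Analysis.Analysis"
begin

text \<open>The finite alphabet is a type of class \<open>finite\<close>, and bi-infinite sequences are
  functions on the integers.\<close>

type_synonym 'a biseq = "int \<Rightarrow> 'a"

definition shift :: "'a biseq \<Rightarrow> 'a biseq" where
  "shift x = (\<lambda>n. x (n + 1))"

definition shift_dist :: "'a biseq \<Rightarrow> 'a biseq \<Rightarrow> real" where
  "shift_dist x y =
     (if x = y then 0 else (1/2) ^ (LEAST m. \<exists>n. m = nat \<bar>n\<bar> \<and> x n \<noteq> y n))"

lemma shift_dist_less_iff:
  "shift_dist x y < (1/2) ^ k \<longleftrightarrow> (\<forall>n. nat \<bar>n\<bar> \<le> k \<longrightarrow> x n = y n)"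
proof (cases "x = y")
  case True
  then show ?thesis by (simp add: shift_dist_def)
next
  case False
  define P where "P = (\<lambda>m. \<exists>n. m = nat \<bar>n\<bar> \<and> x n \<noteq> y n)"
  from False obtain n where "x n \<noteq> y n" by blast
  then have "P (nat \<bar>n\<bar>)" by (auto simp: P_def)
  then have least: "P (Least P)" "\<And>m. P m \<Longrightarrow> Least P \<le> m"
    by (auto intro: LeastI Least_le)
  have "shift_dist x y = (1/2) ^ Least P"
    using False by (simp add: shift_dist_def P_def)
  then have "shift_dist x y < (1/2) ^ k \<longleftrightarrow> k < Least P"
    by (simp add: power_strict_decreasing_iff)
  also have "\<dots> \<longleftrightarrow> (\<forall>m\<le>k. \<not> P m)"
    using least(1) least(2) by (metis not_le order.strict_trans2)
  also have "\<dots> \<longleftrightarrow> (\<forall>n. nat \<bar>n\<bar> \<le> k \<longrightarrow> x n = y n)"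
    by (auto simp: P_def)
  finally show ?thesis .
qed

interpretation full_shift: Metric_space UNIV shift_dist
proof
  fix x y z :: "'a biseq"
  show "0 \<le> shift_dist x y" by (simp add: shift_dist_def)
  show "shift_dist x y = shift_dist y x"
    unfolding shift_dist_def by (simp only: eq_commute[of x y] eq_commute[of "x _" "y _"])
  show "shift_dist x y = 0 \<longleftrightarrow> x = y" by (simp add: shift_dist_def)
  show "shift_dist x z \<le> shift_dist x y + shift_dist y z"
  proof (cases "x = z")
    case True
    then show ?thesis by (simp add: shift_dist_def)
  next
    case False
    then obtain k where k: "shift_dist x z = (1/2) ^ k"
      by (simp only: shift_dist_def if_False that)
    have "\<not> (shift_dist x y < (1/2) ^ k \<and> shift_dist y z < (1/2) ^ k)"
    proof
      assume "shift_dist x y < (1/2) ^ k \<and> shift_dist y z < (1/2) ^ k"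
      then have "shift_dist x z < (1/2) ^ k"
        unfolding shift_dist_less_iff by simp
      with k show False by simp
    qed
    moreover have "0 \<le> shift_dist x y" "0 \<le> shift_dist y z"
      by (simp_all add: shift_dist_def)
    ultimately show ?thesis using k by linarith
  qed
qed

abbreviation (input) subspace_top :: "'a biseq set \<Rightarrow> 'a biseq topology" where
  "subspace_top S \<equiv> subtopology full_shift.mtopology S"

definition shift_space :: "('a::finite) biseq set \<Rightarrow> bool" where
  "shift_space X \<longleftrightarrow> X \<noteq> {} \<and> closedin full_shift.mtopology X \<and> shift ` X = X"

definition cylinder :: "'a biseq set \<Rightarrow> 'a list \<Rightarrow> 'a biseq set" where
  "cylinder X w = {x \<in> X. \<forall>i < length w. x (int i) = w ! i}"

definition lang_n :: "'a biseq set \<Rightarrow> nat \<Rightarrow> 'a list set" where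
  "lang_n X n = {w. length w = n \<and> cylinder X w \<noteq> {}}"

definition lang :: "'a biseq set \<Rightarrow> 'a list set" where
  "lang X = (\<Union>n. lang_n X n)"

definition lang_ge :: "'a biseq set \<Rightarrow> nat \<Rightarrow> 'a list set" where
  "lang_ge X N = {w \<in> lang X. N \<le> length w}"

definition birkhoff_sum :: "('a biseq \<Rightarrow> real) \<Rightarrow> nat \<Rightarrow> 'a biseq \<Rightarrow> real" where
  "birkhoff_sum \<phi> n x = (\<Sum>k<n. \<phi> ((shift ^^ k) x))"

definition word_sup :: "'a biseq set \<Rightarrow> ('a biseq \<Rightarrow> real) \<Rightarrow> 'a list \<Rightarrow> real" where
  "word_sup X \<phi> w = (SUP x \<in> cylinder X w. birkhoff_sum \<phi> (length w) x)"

definition partition_sum :: "'a biseq set \<Rightarrow> ('a biseq \<Rightarrow> real) \<Rightarrow> nat \<Rightarrow> real" where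
  "partition_sum X \<phi> n = (\<Sum>w \<in> lang_n X n. exp (word_sup X \<phi> w))"

definition pressure :: "'a biseq set \<Rightarrow> ('a biseq \<Rightarrow> real) \<Rightarrow> real" where
  "pressure X \<phi> = lim (\<lambda>n. 1 / real n * ln (partition_sum X \<phi> n))"

definition walters :: "'a biseq set \<Rightarrow> ('a biseq \<Rightarrow> real) \<Rightarrow> bool" where
  "walters X \<phi> \<longleftrightarrow>
     (\<forall>\<epsilon>>0. \<exists>k::nat. \<forall>n::nat. \<forall>x\<in>X. \<forall>y\<in>X.
        (\<forall>i \<in> {- int k ..< int n + int k}. x i = y i) \<longrightarrow>
        \<bar>birkhoff_sum \<phi> n x - birkhoff_sum \<phi> n y\<bar> \<le> \<epsilon>)"

definition Wu_loc :: "'a biseq set \<Rightarrow> 'a biseq \<Rightarrow> 'a biseq set" where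
  "Wu_loc X x = {y \<in> X. \<forall>k\<le>0. y k = x k}"

text \<open>The supremum is taken in the extended reals, so it is \<open>-\<infinity>\<close> over the empty set.\<close>

definition word_sup_leaf ::
    "'a biseq set \<Rightarrow> ('a biseq \<Rightarrow> real) \<Rightarrow> 'a biseq \<Rightarrow> 'a list \<Rightarrow> ereal" where
  "word_sup_leaf X \<phi> x w =
     (SUP y \<in> Wu_loc X x \<inter> cylinder X w. ereal (birkhoff_sum \<phi> (length w) y))"

definition exp_ereal :: "ereal \<Rightarrow> ennreal" where
  "exp_ereal a = (case a of ereal r \<Rightarrow> ennreal (exp r) | PInfty \<Rightarrow> \<infinity> | MInfty \<Rightarrow> 0)"

definition covers :: "'a biseq set \<Rightarrow> 'a biseq set \<Rightarrow> nat \<Rightarrow> 'a list set set" where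
  "covers X Z N = {E. E \<subseteq> lang_ge X N \<and> Z \<subseteq> (\<Union>w\<in>E. cylinder X w)}"

text \<open>The leaf measure is a set function, intended for subsets of the local unstable leaf
  of \<open>x\<close>.\<close>

definition leaf_measure ::
    "'a biseq set \<Rightarrow> ('a biseq \<Rightarrow> real) \<Rightarrow> 'a biseq \<Rightarrow> 'a biseq set \<Rightarrow> ennreal" where
  "leaf_measure X \<phi> x Z =
     lim (\<lambda>N. INF E \<in> covers X Z N.
       \<Sum>\<^sub>\<infinity>w\<in>E. exp_ereal (word_sup_leaf X \<phi> x w - ereal (real (length w) * pressure X \<phi>)))"

text \<open>The bracket is meaningful only if \<open>x 0 = y 0\<close>, a condition that is
  part of the definition of a rectangle.\<close>

definition bracket :: "'a biseq \<Rightarrow> 'a biseq \<Rightarrow> 'a biseq" where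
  "bracket x y = (\<lambda>n. if n \<le> 0 then x n else y n)"

definition rectangle :: "'a biseq set \<Rightarrow> 'a biseq set \<Rightarrow> bool" where
  "rectangle X R \<longleftrightarrow> R \<subseteq> X \<and> (\<forall>x\<in>R. \<forall>y\<in>R. x 0 = y 0 \<and> bracket x y \<in> R)"

definition open_rectangles :: "'a biseq set \<Rightarrow> 'a biseq set set" where
  "open_rectangles X = {R. rectangle X R \<and> openin (subspace_top X) R}"

definition Wu_rect :: "'a biseq set \<Rightarrow> 'a biseq set \<Rightarrow> 'a biseq \<Rightarrow> 'a biseq set" where
  "Wu_rect X R x = Wu_loc X x \<inter> R"

definition stable_holonomy :: "'a biseq \<Rightarrow> 'a biseq \<Rightarrow> 'a biseq \<Rightarrow> 'a biseq" where
  "stable_holonomy z y x = bracket y x"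

text \<open>The measurable sets are the Borel sets of the local unstable leaf.\<close>

definition leaf_borel :: "'a biseq set \<Rightarrow> 'a biseq \<Rightarrow> 'a biseq set set" where
  "leaf_borel X x = sigma_sets (Wu_loc X x) {U. openin (subspace_top (Wu_loc X x)) U}"

definition uniformly_continuous_holonomies ::
    "'a biseq set \<Rightarrow> ('a biseq \<Rightarrow> 'a biseq set \<Rightarrow> ennreal) \<Rightarrow> 'a biseq set set \<Rightarrow> bool" where
  "uniformly_continuous_holonomies X m \<R> \<longleftrightarrow>
     (\<forall>\<epsilon>>0. \<exists>\<delta>>0. \<forall>R\<in>\<R>. \<forall>y\<in>R. \<forall>z\<in>R. shift_dist y z < \<delta> \<longrightarrow>
        (\<forall>Y. Y \<in> leaf_borel X y \<and> Y \<subseteq> Wu_rect X R y \<longrightarrow>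
           ennreal (exp (- \<epsilon>)) * m z (stable_holonomy y z ` Y) \<le> m y Y \<and>
           m y Y \<le> ennreal (exp \<epsilon>) * m z (stable_holonomy y z ` Y)))"

end

theory Submission
  imports Defs "HOL-Library.Sublist"
begin

text \<open>For \<open>w\<close> whose cylinder meets the leaf of \<open>y\<close> only inside \<open>R\<close>, every leaf point in the cylinder
  has a holonomy image on the leaf of \<open>z\<close>, agreeing with it from coordinate \<open>- k\<close> on, so the Walters
  property bounds the weight of \<open>w\<close> at \<open>y\<close> by \<open>exp \<epsilon>\<close> times its weight at \<open>z\<close>. Cylinders are defined by
  nonnegative coordinates, so \<open>Y\<close> and its holonomy image have the same covers. The extra length needed
  for the cylinders to lie in \<open>R\<close> is not uniform, so \<open>Y\<close> is cut along the pairwise disjoint cylinders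
  of the minimal words \<open>v\<close> whose leaf cylinder lies in \<open>R\<close>. Leaf measures are countably subadditive
  on arbitrary sets and additive across disjoint cylinders, so the pieces recombine. The reverse
  inequality follows by exchanging \<open>y\<close> and \<open>z\<close>.\<close>

section \<open>Sums of extended nonnegative weights over arbitrary index sets\<close>

text \<open>The library fact \<open>summable_on_ennreal\<close> does not cover arbitrary index types.\<close>

lemma ennreal_summable_on [simp]:
  fixes f :: "'b \<Rightarrow> ennreal"
  shows "f summable_on A"
  by (simp add: nonneg_summable_on_complete)

lemma infsum_ennreal_le_iff:
  fixes f :: "'b \<Rightarrow> ennreal"
  shows "infsum f A \<le> c \<longleftrightarrow> (\<forall>F. finite F \<and> F \<subseteq> A \<longrightarrow> sum f F \<le> c)"
  by (subst nonneg_infsum_complete) (auto simp: SUP_le_iff)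

lemma sum_le_infsum_ennreal:
  fixes f :: "'b \<Rightarrow> ennreal"
  assumes "finite F" "F \<subseteq> A"
  shows "sum f F \<le> infsum f A"
  using infsum_ennreal_le_iff[of f A "infsum f A"] assms by auto

lemma infsum_mono_set_ennreal:
  fixes f :: "'b \<Rightarrow> ennreal"
  assumes "A \<subseteq> B"
  shows "infsum f A \<le> infsum f B"
  using assms by (subst infsum_ennreal_le_iff) (auto intro: sum_le_infsum_ennreal)

lemma infsum_cmult_le_ennreal:
  fixes f :: "'b \<Rightarrow> ennreal"
  shows "(\<Sum>\<^sub>\<infinity>i\<in>A. c * f i) \<le> c * infsum f A"
  unfolding infsum_ennreal_le_iff sum_distrib_left[symmetric]
  by (simp add: mult_left_mono sum_le_infsum_ennreal)

text \<open>The sets \<open>E i\<close> may overlap. Choosing one index \<open>g w\<close> for each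
  \<open>w\<close> of a finite subset counts every weight exactly once.\<close>

lemma infsum_UN_le_ennreal:
  fixes f :: "'b \<Rightarrow> ennreal"
  shows "infsum f (\<Union>i\<in>I. E i) \<le> (\<Sum>\<^sub>\<infinity>i\<in>I. infsum f (E i))"
  unfolding infsum_ennreal_le_iff
proof (intro allI impI, elim conjE)
  fix F assume F: "finite F" "F \<subseteq> (\<Union>i\<in>I. E i)"
  then have "\<forall>w\<in>F. \<exists>i. i \<in> I \<and> w \<in> E i" by auto
  then obtain g where g: "\<And>w. w \<in> F \<Longrightarrow> g w \<in> I \<and> w \<in> E (g w)" by metis
  have "sum f F = (\<Sum>i\<in>g ` F. sum f {w\<in>F. g w = i})"
    using F(1) by (intro sum.group[symmetric]) auto
  also have "\<dots> \<le> (\<Sum>i\<in>g ` F. infsum f (E i))"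
    using F(1) g by (intro sum_mono sum_le_infsum_ennreal) (auto, metis)
  also have "\<dots> \<le> (\<Sum>\<^sub>\<infinity>i\<in>I. infsum f (E i))"
    using F(1) g by (intro sum_le_infsum_ennreal) auto
  finally show "sum f F \<le> (\<Sum>\<^sub>\<infinity>i\<in>I. infsum f (E i))" .
qed

text \<open>Supplies the positive error terms of total at most \<open>e\<close> that a countable
  subadditivity argument spends on its near-optimal covers.\<close>

lemma exists_small_weights_ennreal:
  fixes I :: "'b set" and e :: real
  assumes "countable I" "0 < e"
  shows "\<exists>d :: 'b \<Rightarrow> real. (\<forall>i. 0 < d i) \<and> (\<Sum>\<^sub>\<infinity>i\<in>I. ennreal (d i)) \<le> ennreal e"
proof -
  define d where "d i = e * (1/2) ^ Suc (to_nat_on I i)" for i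
  have "sum (\<lambda>i. ennreal (d i)) F \<le> ennreal e" if F: "finite F" "F \<subseteq> I" for F
  proof -
    have inj: "inj_on (to_nat_on I) F"
      using inj_on_to_nat_on[OF assms(1)] F(2) by (rule inj_on_subset)
    have "(\<Sum>i\<in>F. (1/2) ^ Suc (to_nat_on I i)) = (\<Sum>n\<in>to_nat_on I ` F. (1/2 :: real) ^ Suc n)"
      by (simp add: sum.reindex[OF inj])
    also have "\<dots> \<le> (\<Sum>n. (1/2) ^ Suc n)"
      using F(1) power_half_series by (intro sum_le_suminf) (auto simp: sums_iff)
    also have "\<dots> = 1"
      using power_half_series by (simp add: sums_iff)
    finally have "sum d F \<le> e"
      using assms(2) by (simp add: d_def sum_distrib_left[symmetric] del: power_Suc)
    then show ?thesis
      using assms(2) by (subst sum_ennreal) (auto simp: d_def intro: ennreal_leI)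
  qed
  then show ?thesis
    using assms(2) by (intro exI[of _ d]) (auto simp: infsum_ennreal_le_iff d_def)
qed

section \<open>Exponential factors in extended arithmetic\<close>

text \<open>The two factors are finite and mutually inverse, so moving one across is legitimate even
  when \<open>a\<close> or \<open>b\<close> is infinite.\<close>

lemma ennreal_exp_mult_le_iff:
  "ennreal (exp (- c)) * a \<le> b \<longleftrightarrow> a \<le> ennreal (exp c) * b"
proof -
  have cancel: "ennreal (exp (- c)) * (ennreal (exp c) * t) = t"
    "ennreal (exp c) * (ennreal (exp (- c)) * t) = t" for t
    by (simp_all add: mult.assoc[symmetric] ennreal_mult[symmetric] exp_add[symmetric])
  show ?thesis
    using mult_left_mono[of "ennreal (exp (- c)) * a" b "ennreal (exp c)"]
      mult_left_mono[of a "ennreal (exp c) * b" "ennreal (exp (- c))"] by (auto simp: cancel)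
qed

lemma exp_ereal_mono: "a \<le> b \<Longrightarrow> exp_ereal a \<le> exp_ereal b"
  by (cases a; cases b) (auto simp: exp_ereal_def intro: ennreal_leI)

lemma exp_ereal_add: "exp_ereal (a + ereal c) = ennreal (exp c) * exp_ereal a"
  by (cases a) (auto simp: exp_ereal_def exp_add ennreal_mult'[symmetric] mult.commute
      ennreal_mult_top)

section \<open>The leaf measure as an outer measure\<close>

definition leaf_weight ::
    "'a biseq set \<Rightarrow> ('a biseq \<Rightarrow> real) \<Rightarrow> 'a biseq \<Rightarrow> 'a list \<Rightarrow> ennreal" where
  "leaf_weight X \<phi> x w =
     exp_ereal (word_sup_leaf X \<phi> x w - ereal (real (length w) * pressure X \<phi>))"

text \<open>The approximating infimum at level \<open>N\<close> in the Caratheodory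
  construction.\<close>

definition leaf_content ::
    "'a biseq set \<Rightarrow> ('a biseq \<Rightarrow> real) \<Rightarrow> 'a biseq \<Rightarrow> nat \<Rightarrow> 'a biseq set \<Rightarrow> ennreal" where
  "leaf_content X \<phi> x N Z = (INF E \<in> covers X Z N. infsum (leaf_weight X \<phi> x) E)"

lemma incseq_leaf_content: "incseq (\<lambda>N. leaf_content X \<phi> x N Z)"
  unfolding leaf_content_def
  by (intro monoI INF_superset_mono) (auto simp: covers_def lang_ge_def)

text \<open>Since \<open>lim\<close> is a description operator, convergence has to be shown first. A
  larger \<open>N\<close> leaves fewer covers, so the contents increase to their supremum.\<close>

lemma leaf_content_tendsto: "(\<lambda>N. leaf_content X \<phi> x N Z) \<longlonglongrightarrow> leaf_measure X \<phi> x Z"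
proof -
  have "(\<lambda>N. leaf_content X \<phi> x N Z) \<longlonglongrightarrow> (SUP N. leaf_content X \<phi> x N Z)"
    by (rule LIMSEQ_SUP[OF incseq_leaf_content])
  moreover from this have "leaf_measure X \<phi> x Z = (SUP N. leaf_content X \<phi> x N Z)"
    unfolding leaf_measure_def leaf_content_def leaf_weight_def by (rule limI)
  ultimately show ?thesis by simp
qed

lemma leaf_content_le_measure: "leaf_content X \<phi> x N Z \<le> leaf_measure X \<phi> x Z"
  using incseq_le[OF incseq_leaf_content leaf_content_tendsto] .

lemma leaf_measure_le: "(\<And>N. leaf_content X \<phi> x N Z \<le> c) \<Longrightarrow> leaf_measure X \<phi> x Z \<le> c"
  by (rule LIMSEQ_le_const2[OF leaf_content_tendsto]) auto

lemma leaf_measure_UN_le: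
  assumes "countable I"
  shows "leaf_measure X \<phi> x (\<Union>i\<in>I. A i) \<le> (\<Sum>\<^sub>\<infinity>i\<in>I. leaf_measure X \<phi> x (A i))"
    (is "_ \<le> ?S")
proof (cases "?S = top")
  case False
  show ?thesis
  proof (rule leaf_measure_le)
    fix N
    show "leaf_content X \<phi> x N (\<Union>i\<in>I. A i) \<le> ?S"
    proof (rule ennreal_le_epsilon)
      fix e :: real assume "0 < e"
      then obtain d
        where d: "\<And>i. 0 < d i" "(\<Sum>\<^sub>\<infinity>i\<in>I. ennreal (d i)) \<le> ennreal e"
        using exists_small_weights_ennreal[OF assms] by metis
      have "\<exists>E\<in>covers X (A i) N.
          infsum (leaf_weight X \<phi> x) E < leaf_content X \<phi> x N (A i) + ennreal (d i)"
        if "i \<in> I" for i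
      proof -
        have "leaf_measure X \<phi> x (A i) \<le> ?S"
          using sum_le_infsum_ennreal[of "{i}" I "\<lambda>i. leaf_measure X \<phi> x (A i)"] that by simp
        \<comment> \<open>Only a finite infimum can be approached within a positive error, hence the
          separate case of an infinite total.\<close>
        then have "leaf_content X \<phi> x N (A i) \<noteq> \<infinity>"
          using False leaf_content_le_measure[of X \<phi> x N "A i"] by (auto simp: top_unique)
        then show ?thesis
          using d(1) by (intro INF_approx_ennreal) (auto simp: leaf_content_def)
      qed
      then obtain E where E: "\<And>i. i \<in> I \<Longrightarrow> E i \<in> covers X (A i) N"
        "\<And>i. i \<in> I \<Longrightarrow>
          infsum (leaf_weight X \<phi> x) (E i) < leaf_content X \<phi> x N (A i) + ennreal (d i)"
        by metis
      have "(\<Union>i\<in>I. E i) \<in> covers X (\<Union>i\<in>I. A i) N"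
        using E(1) by (fastforce simp: covers_def)
      then have "leaf_content X \<phi> x N (\<Union>i\<in>I. A i) \<le> infsum (leaf_weight X \<phi> x) (\<Union>i\<in>I. E i)"
        unfolding leaf_content_def by (rule INF_lower)
      also have "\<dots> \<le> (\<Sum>\<^sub>\<infinity>i\<in>I. infsum (leaf_weight X \<phi> x) (E i))"
        by (rule infsum_UN_le_ennreal)
      also have "\<dots> \<le> (\<Sum>\<^sub>\<infinity>i\<in>I. leaf_measure X \<phi> x (A i) + ennreal (d i))"
        using order.trans[OF less_imp_le[OF E(2)] add_right_mono[OF leaf_content_le_measure]]
        by (intro infsum_mono ennreal_summable_on)
      also have "\<dots> = ?S + (\<Sum>\<^sub>\<infinity>i\<in>I. ennreal (d i))"
        by (intro infsum_add) auto
      also have "\<dots> \<le> ?S + ennreal e"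
        using d(2) by (rule add_left_mono)
      finally show "leaf_content X \<phi> x N (\<Union>i\<in>I. A i) \<le> ?S + ennreal e" .
    qed
  qed
qed simp

section \<open>Splitting covers along prefix-incomparable words\<close>

lemma cylinders_imp_prefix:
  assumes "x \<in> cylinder X v" "x \<in> cylinder X w" "length v \<le> length w"
  shows "prefix v w"
proof -
  have "take (length v) w = v"
    using assms by (intro nth_equalityI) (auto simp: cylinder_def)
  then show ?thesis by (metis take_is_prefix)
qed

lemma cylinder_mono_prefix: "prefix v w \<Longrightarrow> cylinder X w \<subseteq> cylinder X v"
  by (auto simp: cylinder_def prefix_def nth_append)

text \<open>Once \<open>N\<close> exceeds \<open>length v\<close>, the words of a cover that meet the cylinder of \<open>v\<close> extend \<open>v\<close>.\<close>

lemma restrict_cover: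
  assumes "E \<in> covers X Z N" "length v \<le> N"
  shows "{w \<in> E. prefix v w} \<in> covers X (Z \<inter> cylinder X v) N"
proof -
  have "\<exists>w\<in>E. prefix v w \<and> p \<in> cylinder X w" if p: "p \<in> Z" "p \<in> cylinder X v" for p
  proof -
    obtain w where w: "w \<in> E" "p \<in> cylinder X w"
      using assms(1) p(1) by (auto simp: covers_def)
    with assms have "length v \<le> length w"
      by (auto simp: covers_def lang_ge_def)
    with p w show ?thesis
      using cylinders_imp_prefix by blast
  qed
  moreover have "E \<subseteq> lang_ge X N"
    using assms(1) by (simp add: covers_def)
  ultimately show ?thesis unfolding covers_def by blast
qed

text \<open>A single cover of \<open>Z\<close> serves all the pieces at once: its words extending
  different members of \<open>F\<close> form disjoint subfamilies, because two prefixes of the same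
  word are comparable.\<close>

lemma sum_leaf_content_cylinders_le:
  assumes "finite F" "\<And>u v. u \<in> F \<Longrightarrow> v \<in> F \<Longrightarrow> prefix u v \<Longrightarrow> u = v"
    and "\<And>v. v \<in> F \<Longrightarrow> length v \<le> N"
  shows "(\<Sum>v\<in>F. leaf_content X \<phi> x N (Z \<inter> cylinder X v)) \<le> leaf_content X \<phi> x N Z"
  unfolding leaf_content_def[of X \<phi> x N Z]
proof (rule INF_greatest)
  fix E assume E: "E \<in> covers X Z N"
  let ?E = "\<lambda>v. {w \<in> E. prefix v w}"
  have "(\<Sum>v\<in>F. leaf_content X \<phi> x N (Z \<inter> cylinder X v)) \<le> (\<Sum>v\<in>F. infsum (leaf_weight X \<phi> x) (?E v))"
    unfolding leaf_content_def using restrict_cover[OF E] assms(3)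
    by (intro sum_mono INF_lower) auto
  also have "\<dots> = infsum (leaf_weight X \<phi> x) (\<Union>v\<in>F. ?E v)"
  proof (rule sum_infsum)
    show "?E u \<inter> ?E v = {}" if "u \<in> F" "v \<in> F" "u \<noteq> v" for u v
      using that assms(2) prefix_same_cases by blast
  qed (rule assms(1), rule ennreal_summable_on)
  also have "\<dots> \<le> infsum (leaf_weight X \<phi> x) E"
    by (rule infsum_mono_set_ennreal) auto
  finally show "(\<Sum>v\<in>F. leaf_content X \<phi> x N (Z \<inter> cylinder X v)) \<le> infsum (leaf_weight X \<phi> x) E" .
qed

text \<open>The converse of subadditivity. The bound on contents requires \<open>N\<close> to exceed
  every word length in use, so it is applied to finite subfamilies and \<open>N\<close> then tends
  to infinity.\<close>

lemma infsum_leaf_measure_cylinders_le: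
  assumes "\<And>u v. u \<in> V \<Longrightarrow> v \<in> V \<Longrightarrow> prefix u v \<Longrightarrow> u = v"
  shows "(\<Sum>\<^sub>\<infinity>v\<in>V. leaf_measure X \<phi> x (Z \<inter> cylinder X v)) \<le> leaf_measure X \<phi> x Z"
  unfolding infsum_ennreal_le_iff
proof (intro allI impI, elim conjE)
  fix F assume F: "finite F" "F \<subseteq> V"
  have "(\<lambda>N. \<Sum>v\<in>F. leaf_content X \<phi> x N (Z \<inter> cylinder X v))
      \<longlonglongrightarrow> (\<Sum>v\<in>F. leaf_measure X \<phi> x (Z \<inter> cylinder X v))"
    by (intro tendsto_sum leaf_content_tendsto)
  moreover have "(\<Sum>v\<in>F. leaf_content X \<phi> x N (Z \<inter> cylinder X v)) \<le> leaf_content X \<phi> x N Z"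
    if N: "Max (length ` F) \<le> N" for N
  proof (rule sum_leaf_content_cylinders_le[OF F(1)])
    show "length v \<le> N" if "v \<in> F" for v
      using order.trans[OF Max_ge N] F(1) that by simp
  qed (use F(2) assms in auto)
  ultimately show "(\<Sum>v\<in>F. leaf_measure X \<phi> x (Z \<inter> cylinder X v)) \<le> leaf_measure X \<phi> x Z"
    using LIMSEQ_le[OF _ leaf_content_tendsto] by blast
qed

section \<open>Comparing two nearby leaves inside a rectangle\<close>

lemma bracket_in_cylinder_iff:
  assumes "y \<in> X" "bracket x y \<in> X" "x 0 = y 0"
  shows "bracket x y \<in> cylinder X w \<longleftrightarrow> y \<in> cylinder X w"
proof -
  have "bracket x y (int i) = y (int i)" for i
    using assms(3) by (simp add: bracket_def)
  with assms(1,2) show ?thesis by (simp add: cylinder_def)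
qed

text \<open>The Birkhoff sums are compared in one direction only; instantiating the locale a second
  time with \<open>y\<close> and \<open>z\<close> exchanged gives the other bound.\<close>

locale close_leaves =
  fixes X :: "'a::finite biseq set" and \<phi> :: "'a biseq \<Rightarrow> real"
    and R :: "'a biseq set" and y z :: "'a biseq" and \<epsilon> :: real
  assumes rect: "rectangle X R" and y: "y \<in> R" and z: "z \<in> R"
    and close: "\<And>n p. p \<in> Wu_rect X R y \<Longrightarrow>
      birkhoff_sum \<phi> n p \<le> birkhoff_sum \<phi> n (bracket z p) + \<epsilon>"
begin

lemma holonomy_image:
  assumes "p \<in> Wu_rect X R y"
  shows "p \<in> X" "bracket z p \<in> X" "z 0 = p 0" "bracket z p \<in> Wu_loc X z"
proof -
  have p: "p \<in> R" using assms by (simp add: Wu_rect_def)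
  with rect z have "p \<in> X" "bracket z p \<in> X" "z 0 = p 0"
    unfolding rectangle_def by blast+
  then show "p \<in> X" "bracket z p \<in> X" "z 0 = p 0" "bracket z p \<in> Wu_loc X z"
    by (simp_all add: Wu_loc_def bracket_def)
qed

lemma holonomy_cylinder:
  assumes "p \<in> Wu_rect X R y"
  shows "bracket z p \<in> cylinder X w \<longleftrightarrow> p \<in> cylinder X w"
  using holonomy_image[OF assms] by (intro bracket_in_cylinder_iff)

text \<open>The supremum at \<open>y\<close> runs over all leaf points of the cylinder, and only
  those in \<open>R\<close> are known to have a holonomy image in \<open>X\<close>. If there are
  none, the left side is 0.\<close>

lemma leaf_weight_le:
  assumes "Wu_loc X y \<inter> cylinder X w \<subseteq> R"
  shows "leaf_weight X \<phi> y w \<le> ennreal (exp \<epsilon>) * leaf_weight X \<phi> z w"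
proof -
  have "word_sup_leaf X \<phi> y w \<le> word_sup_leaf X \<phi> z w + ereal \<epsilon>"
    unfolding word_sup_leaf_def[of X \<phi> y]
  proof (rule SUP_least)
    fix p assume p: "p \<in> Wu_loc X y \<inter> cylinder X w"
    with assms have pR: "p \<in> Wu_rect X R y" by (auto simp: Wu_rect_def)
    have "ereal (birkhoff_sum \<phi> (length w) (bracket z p)) \<le> word_sup_leaf X \<phi> z w"
      unfolding word_sup_leaf_def
      using p holonomy_image[OF pR] holonomy_cylinder[OF pR] by (intro SUP_upper) auto
    then have "ereal (birkhoff_sum \<phi> (length w) (bracket z p)) + ereal \<epsilon>
        \<le> word_sup_leaf X \<phi> z w + ereal \<epsilon>"
      by (rule add_right_mono)
    moreover have "ereal (birkhoff_sum \<phi> (length w) p)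
        \<le> ereal (birkhoff_sum \<phi> (length w) (bracket z p)) + ereal \<epsilon>"
      using close[OF pR] by simp
    ultimately show "ereal (birkhoff_sum \<phi> (length w) p) \<le> word_sup_leaf X \<phi> z w + ereal \<epsilon>"
      by (rule order.trans[rotated])
  qed
  then have "word_sup_leaf X \<phi> y w - ereal c \<le> (word_sup_leaf X \<phi> z w - ereal c) + ereal \<epsilon>" for c
    by (cases "word_sup_leaf X \<phi> y w"; cases "word_sup_leaf X \<phi> z w") auto
  then show ?thesis
    unfolding leaf_weight_def exp_ereal_add[symmetric] by (rule exp_ereal_mono)
qed

lemma leaf_measure_cylinder_le:
  assumes Y: "Y \<subseteq> Wu_rect X R y" and v: "Wu_loc X y \<inter> cylinder X v \<subseteq> R"
  shows "leaf_measure X \<phi> y (Y \<inter> cylinder X v)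
    \<le> ennreal (exp \<epsilon>) * leaf_measure X \<phi> z (bracket z ` Y \<inter> cylinder X v)"
proof (rule leaf_measure_le)
  fix N
  \<comment> \<open>Length at least \<open>length v\<close> lets the cover be restricted to
    extensions of \<open>v\<close>; length at least \<open>N\<close> makes the result admissible at
    level \<open>N\<close>.\<close>
  let ?Z = "bracket z ` Y \<inter> cylinder X v" and ?M = "max N (length v)"
  have "leaf_content X \<phi> y N (Y \<inter> cylinder X v)
      \<le> ennreal (exp \<epsilon>) * infsum (leaf_weight X \<phi> z) E" if E: "E \<in> covers X ?Z ?M" for E
  proof -
    let ?E = "{w \<in> E. prefix v w}"
    have "?E \<in> covers X (?Z \<inter> cylinder X v) ?M"
      using E by (rule restrict_cover) simp
    then have lang: "?E \<subseteq> lang_ge X N" and sub: "?Z \<subseteq> (\<Union>w\<in>?E. cylinder X w)"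
      by (auto simp: covers_def lang_ge_def)
    have "\<exists>w\<in>?E. p \<in> cylinder X w" if p: "p \<in> Y" "p \<in> cylinder X v" for p
    proof -
      have pW: "p \<in> Wu_rect X R y" using p Y by blast
      then have "bracket z p \<in> ?Z" using p holonomy_cylinder by blast
      with sub obtain w where "w \<in> ?E" "bracket z p \<in> cylinder X w" by blast
      then show ?thesis using pW holonomy_cylinder by blast
    qed
    with lang have "?E \<in> covers X (Y \<inter> cylinder X v) N"
      by (auto simp: covers_def)
    then have "leaf_content X \<phi> y N (Y \<inter> cylinder X v) \<le> infsum (leaf_weight X \<phi> y) ?E"
      unfolding leaf_content_def by (rule INF_lower)
    also have "\<dots> \<le> (\<Sum>\<^sub>\<infinity>w\<in>?E. ennreal (exp \<epsilon>) * leaf_weight X \<phi> z w)"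
      using v by (intro infsum_mono ennreal_summable_on leaf_weight_le)
        (blast dest: cylinder_mono_prefix)
    also have "\<dots> \<le> (\<Sum>\<^sub>\<infinity>w\<in>E. ennreal (exp \<epsilon>) * leaf_weight X \<phi> z w)"
      by (rule infsum_mono_set_ennreal) auto
    also have "\<dots> \<le> ennreal (exp \<epsilon>) * infsum (leaf_weight X \<phi> z) E"
      by (rule infsum_cmult_le_ennreal)
    finally show ?thesis .
  qed
  \<comment> \<open>With the constant moved to the left, the bound for each \<open>E\<close> passes
    to the infimum without interchanging infimum and product.\<close>
  then have "ennreal (exp (- \<epsilon>)) * leaf_content X \<phi> y N (Y \<inter> cylinder X v)
      \<le> leaf_content X \<phi> z ?M ?Z"
    unfolding leaf_content_def[of X \<phi> z] by (intro INF_greatest) (simp add: ennreal_exp_mult_le_iff)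
  also have "\<dots> \<le> leaf_measure X \<phi> z ?Z"
    by (rule leaf_content_le_measure)
  finally show "leaf_content X \<phi> y N (Y \<inter> cylinder X v)
      \<le> ennreal (exp \<epsilon>) * leaf_measure X \<phi> z ?Z"
    by (simp add: ennreal_exp_mult_le_iff)
qed

end

section \<open>Cutting an arbitrary subset of the leaf into cylinder pieces\<close>

text \<open>A ball around \<open>p\<close> fixes coordinates on both sides of 0. The leaf already
  fixes the nonpositive ones, so a word recording coordinates 0 to \<open>k\<close>
  suffices.\<close>

lemma openin_cylinder_subset:
  assumes "openin (subspace_top X) R" "p \<in> R"
  obtains v where "p \<in> cylinder X v" "Wu_loc X p \<inter> cylinder X v \<subseteq> R"
proof -
  obtain T where T: "openin full_shift.mtopology T" "R = T \<inter> X"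
    using assms(1) by (auto simp: openin_subtopology)
  with assms(2) obtain r where r: "r > 0" "full_shift.mball p r \<subseteq> T"
    by (auto simp: full_shift.openin_mtopology)
  obtain k where k: "(1/2 :: real) ^ k < r"
    using real_arch_pow_inv[OF r(1), of "1/2"] by auto
  define v where "v = map (\<lambda>i. p (int i)) [0..<Suc k]"
  have "p \<in> cylinder X v"
    using T assms(2) by (auto simp: cylinder_def v_def simp del: upt_Suc)
  moreover have "q \<in> R" if q: "q \<in> Wu_loc X p" "q \<in> cylinder X v" for q
  proof -
    have *: "q (int i) = p (int i)" if "i \<le> k" for i
      using q(2) that by (auto simp: cylinder_def v_def simp del: upt_Suc)
    have "p n = q n" if "nat \<bar>n\<bar> \<le> k" for n
      using q(1) *[of "nat n"] that by (cases "n \<le> 0") (auto simp: Wu_loc_def)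
    then have "shift_dist p q < r"
      using k shift_dist_less_iff[of p q k] by auto
    with r(2) q(1) T(2) show ?thesis by (auto simp: Wu_loc_def)
  qed
  ultimately show thesis using that by blast
qed

lemma (in close_leaves) leaf_measure_holonomy_le:
  assumes op: "openin (subspace_top X) R" and Y: "Y \<subseteq> Wu_rect X R y"
  shows "leaf_measure X \<phi> y Y \<le> ennreal (exp \<epsilon>) * leaf_measure X \<phi> z (bracket z ` Y)"
proof -
  define G where "G v \<longleftrightarrow> Wu_loc X y \<inter> cylinder X v \<subseteq> R" for v
  define V where "V = {v. G v \<and> (\<forall>u. G u \<and> prefix u v \<longrightarrow> u = v)}"
  have "\<exists>v\<in>V. p \<in> cylinder X v" if p: "p \<in> Y" for p
  proof -
    have pW: "p \<in> Wu_loc X y" "p \<in> R" using p Y by (auto simp: Wu_rect_def)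
    then have "Wu_loc X p = Wu_loc X y" by (auto simp: Wu_loc_def)
    with openin_cylinder_subset[OF op pW(2)] obtain v where v: "p \<in> cylinder X v" "G v"
      by (metis G_def)
    then obtain u where u: "G u \<and> prefix u v"
      \<comment> \<open>A shortest good prefix of \<open>v\<close> is minimal: a good prefix of it
        is no shorter, hence equal to it.\<close>
      and least: "\<And>t. G t \<and> prefix t v \<Longrightarrow> length u \<le> length t"
      using ex_has_least_nat[of "\<lambda>u. G u \<and> prefix u v" v length] by auto
    have "t = u" if "G t" "prefix t u" for t
      using that u least[of t] prefix_order.trans[of t u v] by (auto simp: prefix_def)
    with u have "u \<in> V" by (auto simp: V_def)
    with u v show ?thesis using cylinder_mono_prefix by blast
  qed
  then have "Y = (\<Union>v\<in>V. Y \<inter> cylinder X v)" by auto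
  \<comment> \<open>\<open>V\<close> is countable because it consists of words over a finite
    alphabet.\<close>
  then have "leaf_measure X \<phi> y Y \<le> (\<Sum>\<^sub>\<infinity>v\<in>V. leaf_measure X \<phi> y (Y \<inter> cylinder X v))"
    using leaf_measure_UN_le[of V X \<phi> y "\<lambda>v. Y \<inter> cylinder X v"] by simp
  also have "\<dots> \<le> (\<Sum>\<^sub>\<infinity>v\<in>V. ennreal (exp \<epsilon>) * leaf_measure X \<phi> z (bracket z ` Y \<inter> cylinder X v))"
    using Y by (intro infsum_mono leaf_measure_cylinder_le) (auto simp: V_def G_def)
  also have "\<dots> \<le> ennreal (exp \<epsilon>) * (\<Sum>\<^sub>\<infinity>v\<in>V. leaf_measure X \<phi> z (bracket z ` Y \<inter> cylinder X v))"
    by (rule infsum_cmult_le_ennreal)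
  also have "\<dots> \<le> ennreal (exp \<epsilon>) * leaf_measure X \<phi> z (bracket z ` Y)"
    by (intro mult_left_mono infsum_leaf_measure_cylinders_le) (auto simp: V_def)
  finally show ?thesis .
qed

section \<open>From the Walters property to uniform holonomies\<close>

text \<open>\<open>p\<close> and \<open>bracket z p\<close> agree at all positive coordinates, and
  on [-k, 0] because \<open>p\<close> equals \<open>y\<close> there and \<open>y\<close> equals
  \<open>z\<close>. This covers the Walters window for every \<open>n\<close>
  simultaneously.\<close>

lemma close_leavesI:
  assumes "rectangle X R" "y \<in> R" "z \<in> R"
    and walters: "\<And>n p q. p \<in> X \<Longrightarrow> q \<in> X \<Longrightarrow> \<forall>i\<in>{- int k..<int n + int k}. p i = q i \<Longrightarrow>
      \<bar>birkhoff_sum \<phi> n p - birkhoff_sum \<phi> n q\<bar> \<le> \<epsilon>"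
    and agree: "\<And>i. - int k \<le> i \<Longrightarrow> i \<le> 0 \<Longrightarrow> y i = z i"
  shows "close_leaves X \<phi> R y z \<epsilon>"
proof
  fix n p assume p: "p \<in> Wu_rect X R y"
  then have "p \<in> X" "bracket z p \<in> X"
    using assms by (auto simp: Wu_rect_def rectangle_def)
  moreover have "\<forall>i\<in>{- int k..<int n + int k}. p i = bracket z p i"
    using p agree by (auto simp: bracket_def Wu_rect_def Wu_loc_def)
  ultimately have "\<bar>birkhoff_sum \<phi> n p - birkhoff_sum \<phi> n (bracket z p)\<bar> \<le> \<epsilon>"
    by (rule walters)
  then show "birkhoff_sum \<phi> n p \<le> birkhoff_sum \<phi> n (bracket z p) + \<epsilon>" by linarith
qed (use assms in auto)

theorem proposition1p9:
  fixes X :: "('a::finite) biseq set" and \<phi> :: "'a biseq \<Rightarrow> real"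
  assumes "shift_space X"
    and "continuous_map (subspace_top X) euclideanreal \<phi>"
    and "walters X \<phi>"
  shows "uniformly_continuous_holonomies X (leaf_measure X \<phi>) (open_rectangles X)"
  unfolding uniformly_continuous_holonomies_def
proof (intro allI impI)
  fix \<epsilon> :: real assume "0 < \<epsilon>"
  then obtain k where k: "\<And>n p q. p \<in> X \<Longrightarrow> q \<in> X \<Longrightarrow>
      \<forall>i\<in>{- int k..<int n + int k}. p i = q i \<Longrightarrow>
      \<bar>birkhoff_sum \<phi> n p - birkhoff_sum \<phi> n q\<bar> \<le> \<epsilon>"
    using assms(3) unfolding walters_def by metis
  show "\<exists>\<delta>>0. \<forall>R\<in>open_rectangles X. \<forall>y\<in>R. \<forall>z\<in>R. shift_dist y z < \<delta> \<longrightarrow>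
        (\<forall>Y. Y \<in> leaf_borel X y \<and> Y \<subseteq> Wu_rect X R y \<longrightarrow>
           ennreal (exp (- \<epsilon>)) * leaf_measure X \<phi> z (stable_holonomy y z ` Y) \<le> leaf_measure X \<phi> y Y \<and>
           leaf_measure X \<phi> y Y \<le> ennreal (exp \<epsilon>) * leaf_measure X \<phi> z (stable_holonomy y z ` Y))"
  \<comment> \<open>Distance strictly below \<open>(1/2) ^ k\<close> means agreement for |i| \<le>
    k. As \<open>k\<close> depends only on \<epsilon>, the same \<delta> works for every
    rectangle.\<close>
  proof (intro exI[of _ "(1/2) ^ k"] conjI ballI allI impI; (elim conjE)?)
    fix R y z Y
    assume R: "R \<in> open_rectangles X" and y: "y \<in> R" and z: "z \<in> R"
      and dist: "shift_dist y z < (1/2) ^ k" and Y: "Y \<subseteq> Wu_rect X R y"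
    have rect: "rectangle X R" and op: "openin (subspace_top X) R"
      using R by (auto simp: open_rectangles_def)
    have agree: "y i = z i" if "- int k \<le> i" "i \<le> 0" for i
      using dist that unfolding shift_dist_less_iff by auto
    interpret yz: close_leaves X \<phi> R y z \<epsilon>
      using rect y z k agree by (rule close_leavesI)
    interpret zy: close_leaves X \<phi> R z y \<epsilon>
      using rect z y k agree[symmetric] by (rule close_leavesI)
    have hol: "stable_holonomy y z = bracket z" by (auto simp: stable_holonomy_def)
    show "leaf_measure X \<phi> y Y \<le> ennreal (exp \<epsilon>) * leaf_measure X \<phi> z (stable_holonomy y z ` Y)"
      unfolding hol using op Y by (rule yz.leaf_measure_holonomy_le)
    \<comment> \<open>The lower bound is the upper bound from \<open>z\<close> to \<open>y\<close>
      applied to the image of \<open>Y\<close>; the return holonomy recovers \<open>Y\<close> since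
      its points coincide with \<open>y\<close> at nonpositive coordinates.\<close>
    have "bracket y (bracket z p) = p" if "p \<in> Y" for p
      using that Y by (intro ext) (auto simp: bracket_def Wu_rect_def Wu_loc_def)
    then have "bracket y ` bracket z ` Y = Y" by (simp add: image_image)
    moreover have "bracket z ` Y \<subseteq> Wu_rect X R z"
    proof (rule image_subsetI)
      fix p assume "p \<in> Y"
      then have pW: "p \<in> Wu_rect X R y" using Y by blast
      then have "bracket z p \<in> R"
        using rect z unfolding Wu_rect_def rectangle_def by blast
      then show "bracket z p \<in> Wu_rect X R z"
        using yz.holonomy_image(4)[OF pW] by (simp add: Wu_rect_def)
    qed
    ultimately have "leaf_measure X \<phi> z (bracket z ` Y) \<le> ennreal (exp \<epsilon>) * leaf_measure X \<phi> y Y"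
      using zy.leaf_measure_holonomy_le[OF op] by metis
    then show "ennreal (exp (- \<epsilon>)) * leaf_measure X \<phi> z (stable_holonomy y z ` Y)
        \<le> leaf_measure X \<phi> y Y"
      unfolding hol by (simp add: ennreal_exp_mult_le_iff)
  qed simp
qed

end
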